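(* Let $\{Y_i\mid i\in I\}$ be a family of Esakia root systems. Then $\bigotimes_iY_i$ is an Esakia root system.
   Context: An Esakia root system is a Priestley space (compact, with a partial order such that $x\not\le y$ gives a clopen upset containing $x$ but not $y$) in which ${\downarrow}V$ is clopen for every clopen $V$ and ${\uparrow}y$ is a chain for every $y$. $\prod_iY_i$ has the product topology and componentwise order; $\pi_i$ are the projections. For a Priestley space $X$, $\mathsf{CC}(X)$ is the set of nonempty closed chains of $X$, with topology generated by $\Box V=\{C\mid C\subseteq V\}$, $\Diamond V=\{C\mid C\cap V\ne\varnothing\}$ ($V$ clopen) and order $C_1\unlhd C_2$ iff $C_2\subseteq C_1$ and $C_2$ is an upset of $C_1$. $\bigotimes_iY_i=\{C\in\mathsf{CC}(\prod_iY_i)\mid\pi_i[C]\text{ is an upset of }Y_i\text{ for every }i\}$ with the topology and order induced from $\mathsf{CC}(\prod_iY_i)$. *)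

theory Defs
  imports "HOL-Analysis.Analysis"
begin

text \<open>
  An ordered topological space is given by a topology \<open>X\<close>, whose carrier is \<open>topspace X\<close>, and a
  relation \<open>r\<close> on that carrier, with \<open>(x, y) \<in> r\<close> meaning \<open>x \<le> y\<close>.
  Thus \<open>r `` {y}\<close> is the principal upset of \<open>y\<close> and \<open>r\<inverse> `` V\<close> is the downset generated by \<open>V\<close>.
\<close>

definition clopenin :: "'a topology \<Rightarrow> 'a set \<Rightarrow> bool" where
  "clopenin X V \<longleftrightarrow> closedin X V \<and> openin X V"

definition upset_of :: "'a rel \<Rightarrow> 'a set \<Rightarrow> 'a set \<Rightarrow> bool" where
  "upset_of r A U \<longleftrightarrow> U \<subseteq> A \<and> (\<forall>x\<in>U. \<forall>y\<in>A. (x, y) \<in> r \<longrightarrow> y \<in> U)"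

definition priestley_space :: "'a topology \<Rightarrow> 'a rel \<Rightarrow> bool" where
  "priestley_space X r \<longleftrightarrow>
     compact_space X \<and>
     partial_order_on (topspace X) r \<and>
     (\<forall>x\<in>topspace X. \<forall>y\<in>topspace X. (x, y) \<notin> r \<longrightarrow>
        (\<exists>U. clopenin X U \<and> upset_of r (topspace X) U \<and> x \<in> U \<and> y \<notin> U))"

definition esakia_root_system :: "'a topology \<Rightarrow> 'a rel \<Rightarrow> bool" where
  "esakia_root_system X r \<longleftrightarrow>
     priestley_space X r \<and>
     (\<forall>V. clopenin X V \<longrightarrow> clopenin X (r\<inverse> `` V)) \<and>
     (\<forall>y\<in>topspace X. r `` {y} \<in> Chains r)"

text \<open>The componentwise order on the carrier of \<open>product_topology Y I\<close>.\<close>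

definition product_order :: "('i \<Rightarrow> 'a topology) \<Rightarrow> ('i \<Rightarrow> 'a rel) \<Rightarrow> 'i set \<Rightarrow> ('i \<Rightarrow> 'a) rel" where
  "product_order Y R I =
     {(f, g). f \<in> topspace (product_topology Y I) \<and> g \<in> topspace (product_topology Y I) \<and>
              (\<forall>i\<in>I. (f i, g i) \<in> R i)}"

definition CC :: "'a topology \<Rightarrow> 'a rel \<Rightarrow> 'a set set" where
  "CC X r = {C. C \<noteq> {} \<and> closedin X C \<and> C \<in> Chains r}"

definition CC_topology :: "'a topology \<Rightarrow> 'a rel \<Rightarrow> 'a set topology" where
  "CC_topology X r =
     topology_generated_by
       ({{C \<in> CC X r. C \<subseteq> V} | V. clopenin X V} \<union>
        {{C \<in> CC X r. C \<inter> V \<noteq> {}} | V. clopenin X V})"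

definition CC_order :: "'a topology \<Rightarrow> 'a rel \<Rightarrow> 'a set rel" where
  "CC_order X r = {(C1, C2). C1 \<in> CC X r \<and> C2 \<in> CC X r \<and> upset_of r C1 C2}"

text \<open>\<open>topology_generated_by\<close> takes the union of the generators as its carrier;
  here that is all of \<open>CC X r\<close>.\<close>

lemma topspace_CC_topology: "topspace (CC_topology X r) = CC X r"
proof
  show "topspace (CC_topology X r) \<subseteq> CC X r"
    unfolding CC_topology_def topology_generated_by_topspace by blast
next
  have "clopenin X (topspace X)"
    by (simp add: clopenin_def)
  moreover have "CC X r = {C \<in> CC X r. C \<subseteq> topspace X}"
    unfolding CC_def using closedin_subset by blast
  ultimately have "CC X r \<in> {{C \<in> CC X r. C \<subseteq> V} | V. clopenin X V}"
    by (intro CollectI exI[where x = "topspace X"] conjI)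
  then show "CC X r \<subseteq> topspace (CC_topology X r)"
    unfolding CC_topology_def topology_generated_by_topspace by (intro Union_upper UnI1)
qed

definition tensor :: "('i \<Rightarrow> 'a topology) \<Rightarrow> ('i \<Rightarrow> 'a rel) \<Rightarrow> 'i set \<Rightarrow> ('i \<Rightarrow> 'a) set set" where
  "tensor Y R I =
     {C \<in> CC (product_topology Y I) (product_order Y R I).
        \<forall>i\<in>I. upset_of (R i) (topspace (Y i)) ((\<lambda>f. f i) ` C)}"

definition tensor_topology ::
    "('i \<Rightarrow> 'a topology) \<Rightarrow> ('i \<Rightarrow> 'a rel) \<Rightarrow> 'i set \<Rightarrow> ('i \<Rightarrow> 'a) set topology" where
  "tensor_topology Y R I =
     subtopology (CC_topology (product_topology Y I) (product_order Y R I)) (tensor Y R I)"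

definition tensor_order ::
    "('i \<Rightarrow> 'a topology) \<Rightarrow> ('i \<Rightarrow> 'a rel) \<Rightarrow> 'i set \<Rightarrow> ('i \<Rightarrow> 'a) set rel" where
  "tensor_order Y R I =
     Restr (CC_order (product_topology Y I) (product_order Y R I)) (tensor Y R I)"

end

theory Submission
  imports Defs
begin

text \<open>
  The tensor product is a closed subspace of the Vietoris hyperspace of the product \<open>X\<close>, hence compact:
  that \<open>\<pi>\<^sub>i[C]\<close> misses some \<open>y\<close> above one of its points is witnessed by a clopen \<open>V \<ni> y\<close> through
  \<open>C \<subseteq> \<pi>\<^sub>i\<^sup>-\<^sup>1(- V)\<close> and \<open>C \<inter> \<pi>\<^sub>i\<^sup>-\<^sup>1(\<down>V) \<noteq> \<emptyset>\<close>, and \<open>\<down>V\<close> is clopen.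
  It is also stable under passing from \<open>C\<close> to a nonempty closed upset \<open>D\<close> of \<open>C\<close>. If moreover \<open>D \<subseteq> V\<close>
  with \<open>V\<close> clopen, compactness gives a clopen upset \<open>U \<supseteq> D\<close> of \<open>X\<close> with \<open>C \<inter> U \<subseteq> V\<close>. Then \<open>C' \<inter> U \<subseteq> V\<close>
  for all \<open>C'\<close> near \<open>C\<close>, and \<open>C' \<inter> U\<close> is an upset of \<open>C'\<close>; so downsets of open sets are open.
\<close>

section \<open>Clopen sets and Priestley separation\<close>

lemma clopenin_topspace [simp]: "clopenin X (topspace X)"
  by (simp add: clopenin_def)

lemma clopenin_empty [simp]: "clopenin X {}"
  by (simp add: clopenin_def)

lemma clopenin_Int: "clopenin X U \<Longrightarrow> clopenin X V \<Longrightarrow> clopenin X (U \<inter> V)"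
  by (auto simp: clopenin_def)

lemma clopenin_Un: "clopenin X U \<Longrightarrow> clopenin X V \<Longrightarrow> clopenin X (U \<union> V)"
  by (auto simp: clopenin_def)

lemma clopenin_Diff: "clopenin X U \<Longrightarrow> clopenin X V \<Longrightarrow> clopenin X (U - V)"
  by (auto simp: clopenin_def)

lemma clopenin_subset: "clopenin X U \<Longrightarrow> U \<subseteq> topspace X"
  by (auto simp: clopenin_def closedin_subset)

lemma clopenin_preimage:
  "continuous_map X Y f \<Longrightarrow> clopenin Y V \<Longrightarrow> clopenin X {x \<in> topspace X. f x \<in> V}"
  by (auto simp: clopenin_def openin_continuous_map_preimage closedin_continuous_map_preimage)

lemma upset_of_trans: "upset_of r A B \<Longrightarrow> upset_of r B C \<Longrightarrow> upset_of r A C"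
  unfolding upset_of_def by blast

lemma upset_of_restrict: "upset_of r A C \<Longrightarrow> C \<subseteq> B \<Longrightarrow> B \<subseteq> A \<Longrightarrow> upset_of r B C"
  unfolding upset_of_def by blast

text \<open>The complements of the members of \<open>F\<close> form an open cover of
  \<open>L\<close>; closure under intersection puts a single member of \<open>F\<close> inside all
  the finitely many members used. Keeping \<open>F\<close> abstract lets one compactness argument
  serve for clopen upsets around a compact set, for complements of clopen upsets, and for clopen
  neighbourhoods of a point.\<close>

lemma compactin_disjoint_clopen_filter:
  assumes L: "compactin X L"
    and clopen: "\<And>U. U \<in> F \<Longrightarrow> clopenin X U"
    and top: "topspace X \<in> F"
    and Int: "\<And>U V. U \<in> F \<Longrightarrow> V \<in> F \<Longrightarrow> U \<inter> V \<in> F"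
    and sep: "\<And>l. l \<in> L \<Longrightarrow> \<exists>U\<in>F. l \<notin> U"
  shows "\<exists>U\<in>F. U \<inter> L = {}"
proof -
  have "L \<subseteq> \<Union>((\<lambda>U. topspace X - U) ` F)"
    using sep compactin_subset_topspace[OF L] by blast
  moreover have "\<forall>W\<in>(\<lambda>U. topspace X - U) ` F. openin X W"
    using clopen by (auto simp: clopenin_def)
  ultimately obtain \<G> where "finite \<G>" "\<G> \<subseteq> (\<lambda>U. topspace X - U) ` F" "L \<subseteq> \<Union>\<G>"
    using L unfolding compactin_def by metis
  then obtain \<H> where \<H>: "finite \<H>" "\<H> \<subseteq> F" "L \<subseteq> \<Union>((\<lambda>U. topspace X - U) ` \<H>)"
    by (metis finite_subset_image)
  have "\<exists>U\<in>F. \<forall>W\<in>\<H>. U \<subseteq> W"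
    using \<H>(1,2)
  proof (induction \<H>)
    case empty
    then show ?case using top by blast
  next
    case (insert W \<H>)
    then show ?case using Int by (metis inf.coboundedI1 inf.cobounded2 insert_iff insert_subset)
  qed
  then show ?thesis
    using \<H>(3) by blast
qed

section \<open>Order separation in Priestley spaces\<close>

lemma priestley_partial_orderD:
  assumes "priestley_space X r"
  shows "\<And>x. x \<in> topspace X \<Longrightarrow> (x, x) \<in> r"
    and "\<And>x y. (x, y) \<in> r \<Longrightarrow> x \<in> topspace X \<and> y \<in> topspace X"
    and "\<And>x y. (x, y) \<in> r \<Longrightarrow> (y, x) \<in> r \<Longrightarrow> x = y"
    and "\<And>x y z. (x, y) \<in> r \<Longrightarrow> (y, z) \<in> r \<Longrightarrow> (x, z) \<in> r"
  using assms
  unfolding priestley_space_def partial_order_on_def preorder_on_def refl_on_def antisym_def trans_def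
  by (fast+)

lemma priestley_clopen_upset:
  assumes "priestley_space X r" "x \<in> topspace X" "y \<in> topspace X" "(x, y) \<notin> r"
  obtains U where "clopenin X U" "upset_of r (topspace X) U" "x \<in> U" "y \<notin> U"
  using assms unfolding priestley_space_def by blast

text \<open>Compactness is used twice: for fixed \<open>l\<close>, finitely many clopen upsets
  avoiding \<open>l\<close> cover \<open>K\<close>, and their union is one of the same kind; then
  finitely many such unions, one for each of suitably chosen points of \<open>L\<close>, are
  intersected.\<close>

lemma priestley_compact_separation:
  assumes P: "priestley_space X r" and K: "compactin X K" and L: "compactin X L"
    and KL: "\<And>k l. k \<in> K \<Longrightarrow> l \<in> L \<Longrightarrow> (k, l) \<notin> r"
  obtains U where "clopenin X U" "upset_of r (topspace X) U" "K \<subseteq> U" "U \<inter> L = {}"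
proof -
  note sub = compactin_subset_topspace[OF K] compactin_subset_topspace[OF L]
  have "\<exists>U\<in>{U. clopenin X U \<and> upset_of r (topspace X) U \<and> K \<subseteq> U}. U \<inter> L = {}"
  proof (rule compactin_disjoint_clopen_filter[OF L])
    fix l assume l: "l \<in> L"
    \<comment> \<open>Clopen upsets avoiding \<open>l\<close> are closed under union, so their
      complements are closed under intersection. A complement disjoint from \<open>K\<close> belongs
      to an upset that contains \<open>K\<close>.\<close>
    have "\<exists>W\<in>{topspace X - U | U. clopenin X U \<and> upset_of r (topspace X) U \<and> l \<notin> U}. W \<inter> K = {}"
    proof (rule compactin_disjoint_clopen_filter[OF K])
      show "topspace X \<in> {topspace X - U | U. clopenin X U \<and> upset_of r (topspace X) U \<and> l \<notin> U}"
        by (intro CollectI exI[of _ "{}"]) (simp add: upset_of_def)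
    next
      fix V W
      assume "V \<in> {topspace X - U | U. clopenin X U \<and> upset_of r (topspace X) U \<and> l \<notin> U}"
        and "W \<in> {topspace X - U | U. clopenin X U \<and> upset_of r (topspace X) U \<and> l \<notin> U}"
      then obtain A B where AB: "V = topspace X - A" "W = topspace X - B" "clopenin X A" "clopenin X B"
        "upset_of r (topspace X) A" "upset_of r (topspace X) B" "l \<notin> A" "l \<notin> B"
        by blast
      have "V \<inter> W = topspace X - (A \<union> B)" "clopenin X (A \<union> B)" "l \<notin> A \<union> B"
        "upset_of r (topspace X) (A \<union> B)"
        using AB by (auto simp: clopenin_Un upset_of_def)
      then show "V \<inter> W \<in> {topspace X - U | U. clopenin X U \<and> upset_of r (topspace X) U \<and> l \<notin> U}"
        by blast
    next
      fix k assume k: "k \<in> K"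
      then obtain U where "clopenin X U" "upset_of r (topspace X) U" "k \<in> U" "l \<notin> U"
        using priestley_clopen_upset[OF P, of k l] KL[OF k l] sub l by blast
      then show "\<exists>W\<in>{topspace X - U | U. clopenin X U \<and> upset_of r (topspace X) U \<and> l \<notin> U}. k \<notin> W"
        by blast
    qed (auto intro: clopenin_Diff)
    then show "\<exists>U\<in>{U. clopenin X U \<and> upset_of r (topspace X) U \<and> K \<subseteq> U}. l \<notin> U"
      using sub by blast
  next
    show "topspace X \<in> {U. clopenin X U \<and> upset_of r (topspace X) U \<and> K \<subseteq> U}"
      using sub by (auto simp: upset_of_def)
  qed (auto intro: clopenin_Int simp: upset_of_def)
  then show ?thesis
    using that by blast
qed

text \<open>By antisymmetry, distinct points fail to be related in at least one direction. Depending
  on which, either a clopen upset or the complement of one contains \<open>x\<close> and avoids the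
  given point of \<open>K\<close>.\<close>

lemma priestley_clopen_nhd:
  assumes P: "priestley_space X r" and K: "compactin X K" and x: "x \<in> topspace X" "x \<notin> K"
  obtains V where "clopenin X V" "x \<in> V" "V \<inter> K = {}"
proof -
  have "\<exists>V\<in>{V. clopenin X V \<and> x \<in> V}. V \<inter> K = {}"
  proof (rule compactin_disjoint_clopen_filter[OF K])
    fix k assume k: "k \<in> K"
    then have kX: "k \<in> topspace X"
      using compactin_subset_topspace[OF K] by blast
    consider "(x, k) \<notin> r" | "(k, x) \<notin> r"
      using priestley_partial_orderD(3)[OF P] k x(2) by blast
    then show "\<exists>V\<in>{V. clopenin X V \<and> x \<in> V}. k \<notin> V"
    proof cases
      case 1
      then show ?thesis
        using priestley_clopen_upset[OF P x(1) kX] by blast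
    next
      case 2
      then obtain U where "clopenin X U" "k \<in> U" "x \<notin> U"
        using priestley_clopen_upset[OF P kX x(1)] by blast
      then have "topspace X - U \<in> {V. clopenin X V \<and> x \<in> V}" "k \<notin> topspace X - U"
        using x(1) by (auto intro: clopenin_Diff)
      then show ?thesis
        by blast
    qed
  qed (auto intro: clopenin_Int simp: x)
  then show ?thesis
    using that by blast
qed

text \<open>A point outside the downset of \<open>V\<close> is not below any element of the compact
  set \<open>V\<close>. A clopen upset that contains the point and misses \<open>V\<close> misses
  the whole downset, because it is an upset.\<close>

lemma priestley_closedin_downset:
  assumes P: "priestley_space X r" and V: "closedin X V"
  shows "closedin X (r\<inverse> `` V)"
proof -
  have cV: "compactin X V"
    using P V by (simp add: priestley_space_def closedin_compact_space)
  have "openin X (topspace X - r\<inverse> `` V)"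
  proof (subst openin_subopen, intro ballI)
    fix z assume z: "z \<in> topspace X - r\<inverse> `` V"
    then have "compactin X {z}"
      by simp
    moreover have "\<And>k l. k \<in> {z} \<Longrightarrow> l \<in> V \<Longrightarrow> (k, l) \<notin> r"
      using z by blast
    ultimately obtain U where U: "clopenin X U" "upset_of r (topspace X) U" "{z} \<subseteq> U" "U \<inter> V = {}"
      using priestley_compact_separation[OF P _ cV] by metis
    have "U \<subseteq> topspace X - r\<inverse> `` V"
      using U closedin_subset[OF V] unfolding upset_of_def by blast
    then show "\<exists>T. openin X T \<and> z \<in> T \<and> T \<subseteq> topspace X - r\<inverse> `` V"
      using U unfolding clopenin_def by blast
  qed
  moreover have "r\<inverse> `` V \<subseteq> topspace X"
    using priestley_partial_orderD(2)[OF P] by blast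
  ultimately show ?thesis
    by (simp add: closedin_def)
qed

text \<open>Compactness is Tychonoff's theorem. If the order fails, it fails in some coordinate, and
  a separating clopen upset of that factor pulls back along the projection.\<close>

lemma priestley_space_product:
  assumes P: "\<And>i. i \<in> I \<Longrightarrow> priestley_space (Y i) (R i)"
  shows "priestley_space (product_topology Y I) (product_order Y R I)"
  unfolding priestley_space_def
proof (intro conjI ballI impI)
  show "compact_space (product_topology Y I)"
    using P by (auto simp: compact_space_product_topology priestley_space_def)
  have "refl_on (topspace (product_topology Y I)) (product_order Y R I)"
    by (auto simp: refl_on_def product_order_def intro!: priestley_partial_orderD(1)[OF P] dest: PiE_mem)
  moreover have "trans (product_order Y R I)"
    unfolding trans_def product_order_def using priestley_partial_orderD(4)[OF P] by blast
  moreover have "antisym (product_order Y R I)"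
  proof (rule antisymI)
    fix f g assume fg: "(f, g) \<in> product_order Y R I" "(g, f) \<in> product_order Y R I"
    show "f = g"
    proof (rule PiE_ext)
      show "f \<in> (\<Pi>\<^sub>E i\<in>I. topspace (Y i))" "g \<in> (\<Pi>\<^sub>E i\<in>I. topspace (Y i))"
        using fg by (simp_all add: product_order_def)
      show "f i = g i" if "i \<in> I" for i
        using fg that by (intro priestley_partial_orderD(3)[OF P[OF that]]) (simp_all add: product_order_def)
    qed
  qed
  ultimately show "partial_order_on (topspace (product_topology Y I)) (product_order Y R I)"
    unfolding partial_order_on_def preorder_on_def by (auto simp: product_order_def)
  fix f g
  assume f: "f \<in> topspace (product_topology Y I)" and g: "g \<in> topspace (product_topology Y I)"
    and "(f, g) \<notin> product_order Y R I"
  then obtain i where i: "i \<in> I" "(f i, g i) \<notin> R i"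
    by (auto simp: product_order_def)
  moreover have "f i \<in> topspace (Y i)" "g i \<in> topspace (Y i)"
    using f g i(1) by (auto simp: PiE_mem)
  ultimately obtain U where U: "clopenin (Y i) U" "upset_of (R i) (topspace (Y i)) U" "f i \<in> U" "g i \<notin> U"
    using priestley_clopen_upset[OF P] by metis
  let ?U = "{h \<in> topspace (product_topology Y I). h i \<in> U}"
  have "clopenin (product_topology Y I) ?U"
    by (rule clopenin_preimage[where Y = "Y i"]) (intro continuous_map_product_projection i U)+
  moreover have "upset_of (product_order Y R I) (topspace (product_topology Y I)) ?U"
    unfolding upset_of_def
  proof (intro conjI ballI impI)
    fix h k assume "h \<in> ?U" "k \<in> topspace (product_topology Y I)" "(h, k) \<in> product_order Y R I"
    then have "h i \<in> U" "k i \<in> topspace (Y i)" "(h i, k i) \<in> R i"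
      using i(1) by (auto simp: product_order_def PiE_mem)
    then have "k i \<in> U"
      using U(2) by (simp add: upset_of_def)
    then show "k \<in> ?U"
      using \<open>k \<in> topspace (product_topology Y I)\<close> by blast
  qed blast
  ultimately show "\<exists>U. clopenin (product_topology Y I) U \<and>
      upset_of (product_order Y R I) (topspace (product_topology Y I)) U \<and> f \<in> U \<and> g \<notin> U"
    using f U by (intro exI[of _ ?U]) auto
qed

section \<open>The Vietoris topology generated by clopen sets\<close>

text \<open>The family of sets is a parameter, so that the hyperspace of all nonempty closed sets,
  \<open>CC\<close> and the tensor product carry instances of one construction and can be
  compared.\<close>

definition clopen_vietoris :: "'a topology \<Rightarrow> 'a set set \<Rightarrow> 'a set topology" where
  "clopen_vietoris X \<K> =
     topology_generated_by
       ({{C \<in> \<K>. C \<subseteq> V} | V. clopenin X V} \<union> {{C \<in> \<K>. C \<inter> V \<noteq> {}} | V. clopenin X V})"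

lemma CC_topology_eq: "CC_topology X r = clopen_vietoris X (CC X r)"
  by (simp add: CC_topology_def clopen_vietoris_def)

lemma openin_clopen_vietoris_subset:
  "clopenin X V \<Longrightarrow> openin (clopen_vietoris X \<K>) {C \<in> \<K>. C \<subseteq> V}"
  unfolding clopen_vietoris_def by (rule topology_generated_by_Basis) blast

lemma openin_clopen_vietoris_meets:
  "clopenin X V \<Longrightarrow> openin (clopen_vietoris X \<K>) {C \<in> \<K>. C \<inter> V \<noteq> {}}"
  unfolding clopen_vietoris_def by (rule topology_generated_by_Basis) blast

lemma topspace_clopen_vietoris:
  assumes "\<And>C. C \<in> \<K> \<Longrightarrow> C \<subseteq> topspace X"
  shows "topspace (clopen_vietoris X \<K>) = \<K>"
proof
  show "topspace (clopen_vietoris X \<K>) \<subseteq> \<K>"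
    unfolding clopen_vietoris_def topology_generated_by_topspace by blast
  have "{C \<in> \<K>. C \<subseteq> topspace X} = \<K>"
    using assms by blast
  then show "\<K> \<subseteq> topspace (clopen_vietoris X \<K>)"
    using openin_subset[OF openin_clopen_vietoris_subset[OF clopenin_topspace, of X \<K>]] by simp
qed

lemma clopenin_clopen_vietoris_meets:
  assumes \<K>: "\<And>C. C \<in> \<K> \<Longrightarrow> C \<subseteq> topspace X" and V: "clopenin X V"
  shows "clopenin (clopen_vietoris X \<K>) {C \<in> \<K>. C \<inter> V \<noteq> {}}"
proof -
  have "\<K> - {C \<in> \<K>. C \<inter> V \<noteq> {}} = {C \<in> \<K>. C \<subseteq> topspace X - V}"
    using \<K> by blast
  then show ?thesis
    using openin_clopen_vietoris_subset[OF clopenin_Diff[OF clopenin_topspace V], of \<K>]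
      openin_clopen_vietoris_meets[OF V, of \<K>] topspace_clopen_vietoris[of \<K>, OF \<K>]
    by (auto simp: clopenin_def closedin_def)
qed

text \<open>Finitely many box conditions merge into one, since \<open>C \<subseteq> V\<close> and
  \<open>C \<subseteq> V'\<close> amount to \<open>C \<subseteq> V \<inter> V'\<close>. Diamond
  conditions do not merge, whence one set \<open>V\<close> but a finite family
  \<open>\<W>\<close>.\<close>

lemma clopen_vietoris_basis:
  assumes \<K>: "\<And>C. C \<in> \<K> \<Longrightarrow> C \<subseteq> topspace X"
    and S: "openin (clopen_vietoris X \<K>) S" and D: "D \<in> S"
  obtains V \<W> where "clopenin X V" "finite \<W>" "\<And>W. W \<in> \<W> \<Longrightarrow> clopenin X W"
    "D \<subseteq> V" "\<And>W. W \<in> \<W> \<Longrightarrow> D \<inter> W \<noteq> {}"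
    "\<And>C. C \<in> \<K> \<Longrightarrow> C \<subseteq> V \<Longrightarrow> (\<And>W. W \<in> \<W> \<Longrightarrow> C \<inter> W \<noteq> {}) \<Longrightarrow> C \<in> S"
proof -
  have "generate_topology_on ({{C \<in> \<K>. C \<subseteq> V} | V. clopenin X V} \<union>
      {{C \<in> \<K>. C \<inter> V \<noteq> {}} | V. clopenin X V}) S"
    using S unfolding clopen_vietoris_def by (rule openin_topology_generated_by)
  then have "\<exists>V \<W>. clopenin X V \<and> finite \<W> \<and> (\<forall>W\<in>\<W>. clopenin X W \<and> D \<inter> W \<noteq> {}) \<and> D \<subseteq> V \<and>
      (\<forall>C\<in>\<K>. C \<subseteq> V \<longrightarrow> (\<forall>W\<in>\<W>. C \<inter> W \<noteq> {}) \<longrightarrow> C \<in> S)"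
    using D
  proof induction
    case Empty
    then show ?case by simp
  next
    case (Int a b)
    obtain V \<W> where 1: "clopenin X V" "finite \<W>" "\<forall>W\<in>\<W>. clopenin X W \<and> D \<inter> W \<noteq> {}" "D \<subseteq> V"
      "\<forall>C\<in>\<K>. C \<subseteq> V \<longrightarrow> (\<forall>W\<in>\<W>. C \<inter> W \<noteq> {}) \<longrightarrow> C \<in> a"
      using Int.IH(1)[OF IntD1[OF Int.prems]] by blast
    obtain V' \<W>' where 2: "clopenin X V'" "finite \<W>'" "\<forall>W\<in>\<W>'. clopenin X W \<and> D \<inter> W \<noteq> {}" "D \<subseteq> V'"
      "\<forall>C\<in>\<K>. C \<subseteq> V' \<longrightarrow> (\<forall>W\<in>\<W>'. C \<inter> W \<noteq> {}) \<longrightarrow> C \<in> b"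
      using Int.IH(2)[OF IntD2[OF Int.prems]] by blast
    show ?case
      using 1 2 by (intro exI[of _ "V \<inter> V'"] exI[of _ "\<W> \<union> \<W>'"]) (simp add: clopenin_Int ball_Un)
  next
    case (UN \<S>)
    then obtain T where T: "T \<in> \<S>" "D \<in> T"
      by blast
    obtain V \<W> where "clopenin X V" "finite \<W>" "\<forall>W\<in>\<W>. clopenin X W \<and> D \<inter> W \<noteq> {}" "D \<subseteq> V"
      "\<forall>C\<in>\<K>. C \<subseteq> V \<longrightarrow> (\<forall>W\<in>\<W>. C \<inter> W \<noteq> {}) \<longrightarrow> C \<in> T"
      using UN.IH[OF T] by blast
    then show ?case
      using T(1) by (intro exI[of _ V] exI[of _ \<W>]) blast
  next
    case (Basis T)
    then consider V where "clopenin X V" "T = {C \<in> \<K>. C \<subseteq> V}"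
      | V where "clopenin X V" "T = {C \<in> \<K>. C \<inter> V \<noteq> {}}"
      by blast
    then show ?case
    proof cases
      case 1
      then show ?thesis
        using Basis.prems by (intro exI[of _ V] exI[of _ "{}"]) simp
    next
      case 2
      then show ?thesis
        using Basis.prems \<K> by (intro exI[of _ "topspace X"] exI[of _ "{V}"]) simp
    qed
  qed
  then show ?thesis
    using that by metis
qed

text \<open>The generators for \<open>\<K>\<close> trace on \<open>\<A>\<close> exactly the
  generators for \<open>\<A>\<close>. This serves both to transfer compactness to a closed subfamily
  and to identify the tensor topology.\<close>

lemma subtopology_clopen_vietoris:
  assumes "\<A> \<subseteq> \<K>"
  shows "subtopology (clopen_vietoris X \<K>) \<A> = clopen_vietoris X \<A>"
  unfolding topology_eq
proof (intro allI iffI)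
  fix S assume "openin (subtopology (clopen_vietoris X \<K>) \<A>) S"
  then obtain T where T: "openin (clopen_vietoris X \<K>) T" "S = T \<inter> \<A>"
    by (auto simp: openin_subtopology)
  from T(1) have "generate_topology_on ({{C \<in> \<K>. C \<subseteq> V} | V. clopenin X V} \<union>
      {{C \<in> \<K>. C \<inter> V \<noteq> {}} | V. clopenin X V}) T"
    unfolding clopen_vietoris_def by (rule openin_topology_generated_by)
  then have "openin (clopen_vietoris X \<A>) (T \<inter> \<A>)"
  proof induction
    case (Int a b)
    show ?case
      using openin_Int[OF Int.IH] by (simp add: Int_ac)
  next
    case (UN \<S>)
    have "openin (clopen_vietoris X \<A>) (\<Union>S\<in>\<S>. S \<inter> \<A>)"
      using UN.IH by (intro openin_Union) blast
    moreover have "\<Union>\<S> \<inter> \<A> = (\<Union>S\<in>\<S>. S \<inter> \<A>)"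
      by blast
    ultimately show ?case
      by (simp only:)
  next
    case (Basis s)
    then consider V where "clopenin X V" "s = {C \<in> \<K>. C \<subseteq> V}"
      | V where "clopenin X V" "s = {C \<in> \<K>. C \<inter> V \<noteq> {}}"
      by blast
    then show ?case
    proof cases
      case 1
      then have "s \<inter> \<A> = {C \<in> \<A>. C \<subseteq> V}"
        using assms by blast
      then show ?thesis
        using openin_clopen_vietoris_subset 1 by metis
    next
      case 2
      then have "s \<inter> \<A> = {C \<in> \<A>. C \<inter> V \<noteq> {}}"
        using assms by blast
      then show ?thesis
        using openin_clopen_vietoris_meets 2 by metis
    qed
  qed simp
  then show "openin (clopen_vietoris X \<A>) S"
    using T by simp
next
  fix S assume "openin (clopen_vietoris X \<A>) S"
  then have "generate_topology_on ({{C \<in> \<A>. C \<subseteq> V} | V. clopenin X V} \<union>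
      {{C \<in> \<A>. C \<inter> V \<noteq> {}} | V. clopenin X V}) S"
    unfolding clopen_vietoris_def by (rule openin_topology_generated_by)
  then show "openin (subtopology (clopen_vietoris X \<K>) \<A>) S"
  proof (rule generate_topology_on_coarsest[OF istopology_openin, rotated])
    fix s assume "s \<in> {{C \<in> \<A>. C \<subseteq> V} | V. clopenin X V} \<union> {{C \<in> \<A>. C \<inter> V \<noteq> {}} | V. clopenin X V}"
    then consider V where "clopenin X V" "s = {C \<in> \<A>. C \<subseteq> V}"
      | V where "clopenin X V" "s = {C \<in> \<A>. C \<inter> V \<noteq> {}}"
      by blast
    then show "openin (subtopology (clopen_vietoris X \<K>) \<A>) s"
    proof cases
      case 1
      then have "s = {C \<in> \<K>. C \<subseteq> V} \<inter> \<A>"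
        using assms by blast
      then show ?thesis
        using openin_clopen_vietoris_subset[OF 1(1)] openin_subtopology by blast
    next
      case 2
      then have "s = {C \<in> \<K>. C \<inter> V \<noteq> {}} \<inter> \<A>"
        using assms by blast
      then show ?thesis
        using openin_clopen_vietoris_meets[OF 2(1)] openin_subtopology by blast
    qed
  qed
qed

section \<open>Compactness of the Vietoris hyperspace\<close>

lemma compact_space_topology_generated_by:
  assumes "\<And>\<C>. \<C> \<subseteq> \<B> \<Longrightarrow> \<Union>\<C> = \<Union>\<B> \<Longrightarrow> \<exists>\<C>'. finite \<C>' \<and> \<C>' \<subseteq> \<C> \<and> \<Union>\<C>' = \<Union>\<B>"
  shows "compact_space (topology_generated_by \<B>)"
proof (rule Alexander_subbase)
  \<comment> \<open>Alexander's lemma speaks of arbitrary unions of finite intersections of subbasic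
    sets, relative to the carrier. Each of the two topologies contains the generators of the
    other.\<close>
  show "topology (arbitrary union_of (finite intersection_of (\<lambda>x. x \<in> \<B>) relative_to \<Union>\<B>))
      = topology_generated_by \<B>" (is "?T = _")
    unfolding topology_eq
  proof (intro allI iffI)
    fix S assume "openin ?T S"
    then show "openin (topology_generated_by \<B>) S"
      using minimal_topology_subbase[of "\<lambda>x. x \<in> \<B>" "topology_generated_by \<B>" "\<Union>\<B>"]
      by (metis openin_topspace topology_generated_by_Basis topology_generated_by_topspace)
  next
    fix S assume "openin (topology_generated_by \<B>) S"
    then have "generate_topology_on \<B> S"
      by (rule openin_topology_generated_by)
    moreover have "openin ?T B" if "B \<in> \<B>" for B
      unfolding openin_subbase using that
      by (intro arbitrary_union_of_inc relative_to_subset_inc finite_intersection_of_inc) auto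
    ultimately show "openin ?T S"
      using generate_topology_on_coarsest[OF istopology_openin] by blast
  qed
qed (use assms in simp)

text \<open>The family must contain every nonempty closed set: the argument tests a cover by
  generators on a closed set \<open>F\<close> built from that cover, and \<open>F\<close> need not
  be a chain. Compactness for families of chains is therefore derived later, from closedness in this
  hyperspace.\<close>

lemma compact_space_clopen_vietoris:
  assumes X: "compact_space X"
  shows "compact_space (clopen_vietoris X {C. closedin X C \<and> C \<noteq> {}})"
proof -
  define \<K> where "\<K> = {C. closedin X C \<and> C \<noteq> {}}"
  define \<B> where "\<B> = {{C \<in> \<K>. C \<subseteq> V} | V. clopenin X V} \<union> {{C \<in> \<K>. C \<inter> V \<noteq> {}} | V. clopenin X V}"
  have \<K>: "\<And>C. C \<in> \<K> \<Longrightarrow> C \<subseteq> topspace X"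
    by (simp add: \<K>_def closedin_subset)
  have \<B>: "clopen_vietoris X \<K> = topology_generated_by \<B>" "\<Union>\<B> = \<K>"
    using topspace_clopen_vietoris[of \<K>, OF \<K>] by (simp_all add: clopen_vietoris_def \<B>_def)
  have "compact_space (topology_generated_by \<B>)"
  proof (rule compact_space_topology_generated_by)
    fix \<C> assume \<C>: "\<C> \<subseteq> \<B>" "\<Union>\<C> = \<Union>\<B>"
    define \<W> where "\<W> = {W. clopenin X W \<and> {C \<in> \<K>. C \<inter> W \<noteq> {}} \<in> \<C>}"
    \<comment> \<open>\<open>F\<close> is what the diamonds of the cover leave over: it meets no
      \<open>W\<close> in \<open>\<W>\<close>. If it is empty, the sets in \<open>\<W>\<close> cover
      the space, and finitely many diamonds suffice.\<close>
    define F where "F = topspace X - \<Union>\<W>"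
    have \<W>_open: "\<forall>W\<in>\<W>. openin X W"
      by (auto simp: \<W>_def clopenin_def)
    then have F: "closedin X F"
      by (auto simp: F_def)
    have cover: "\<exists>\<W>'. finite \<W>' \<and> \<W>' \<subseteq> \<W> \<and> K \<subseteq> \<Union>\<W>'" if "compactin X K" "K \<inter> F = {}" for K
    proof -
      have "K \<subseteq> \<Union>\<W>"
        using that compactin_subset_topspace unfolding F_def by blast
      then show ?thesis
        using that(1) \<W>_open unfolding compactin_def by metis
    qed
    have sub: "(\<lambda>W. {C \<in> \<K>. C \<inter> W \<noteq> {}}) ` \<W>' \<subseteq> \<C>" if "\<W>' \<subseteq> \<W>" for \<W>'
      using that by (auto simp: \<W>_def)
    show "\<exists>\<C>'. finite \<C>' \<and> \<C>' \<subseteq> \<C> \<and> \<Union>\<C>' = \<Union>\<B>"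
    proof (cases "F = {}")
      case True
      then obtain \<W>' where \<W>': "finite \<W>'" "\<W>' \<subseteq> \<W>" "topspace X \<subseteq> \<Union>\<W>'"
        using cover[of "topspace X"] X by (auto simp: compact_space_def)
      have "C \<in> \<Union>((\<lambda>W. {C \<in> \<K>. C \<inter> W \<noteq> {}}) ` \<W>')" if C: "C \<in> \<K>" for C
      proof -
        obtain x where "x \<in> C"
          using C by (auto simp: \<K>_def)
        then show ?thesis
          using C \<K>[OF C] \<W>'(3) by blast
      qed
      then have "\<Union>((\<lambda>W. {C \<in> \<K>. C \<inter> W \<noteq> {}}) ` \<W>') = \<K>"
        by blast
      then show ?thesis
        using \<W>'(1) sub[OF \<W>'(2)] \<B>(2)
        by (intro exI[of _ "(\<lambda>W. {C \<in> \<K>. C \<inter> W \<noteq> {}}) ` \<W>'"]) simp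
    next
      case False
      \<comment> \<open>\<open>F\<close> is itself a point of the hyperspace, so some member of the
        cover contains it. No diamond of the cover does, so it must be a box, given by some
        \<open>V\<close> that contains \<open>F\<close>.\<close>
      then have "F \<in> \<Union>\<C>"
        using F \<C>(2) \<B>(2) by (simp add: \<K>_def)
      then obtain T where T: "T \<in> \<C>" "F \<in> T"
        by blast
      have "T \<in> \<B>"
        using T(1) \<C>(1) by blast
      then consider V where "clopenin X V" "T = {C \<in> \<K>. C \<subseteq> V}"
        | W where "clopenin X W" "T = {C \<in> \<K>. C \<inter> W \<noteq> {}}"
        unfolding \<B>_def by blast
      then obtain V where V: "clopenin X V" "T = {C \<in> \<K>. C \<subseteq> V}"
      proof cases
        case (2 W)
        then have "W \<in> \<W>"
          using T(1) by (simp add: \<W>_def)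
        then have "F \<inter> W = {}"
          by (auto simp: F_def)
        then show ?thesis
          using T(2) 2(2) by simp
      qed (rule that)
      have "compactin X (topspace X - V)"
        using clopenin_Diff[OF clopenin_topspace V(1)] X by (simp add: clopenin_def closedin_compact_space)
      moreover have "(topspace X - V) \<inter> F = {}"
        using T(2) V(2) by blast
      ultimately obtain \<W>' where \<W>': "finite \<W>'" "\<W>' \<subseteq> \<W>" "topspace X - V \<subseteq> \<Union>\<W>'"
        using cover by metis
      \<comment> \<open>A closed set inside \<open>V\<close> lies in the box \<open>T\<close>; any
        other has a point outside \<open>V\<close>, hence in one of the finitely many
        \<open>W\<close> covering the complement of \<open>V\<close>.\<close>
      have "C \<in> \<Union>(insert T ((\<lambda>W. {C \<in> \<K>. C \<inter> W \<noteq> {}}) ` \<W>'))" if C: "C \<in> \<K>" for C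
      proof (cases "C \<subseteq> V")
        case True
        then show ?thesis
          using C by (simp add: V(2))
      next
        case False
        then obtain x where "x \<in> C" "x \<in> topspace X - V"
          using \<K>[OF C] by blast
        then obtain W where "W \<in> \<W>'" "C \<inter> W \<noteq> {}"
          using \<W>'(3) by blast
        then show ?thesis
          using C by simp blast
      qed
      then have "\<Union>(insert T ((\<lambda>W. {C \<in> \<K>. C \<inter> W \<noteq> {}}) ` \<W>')) = \<K>"
        using V(2) by blast
      then show ?thesis
        using \<W>'(1) sub[OF \<W>'(2)] \<B>(2) T(1)
        by (intro exI[of _ "insert T ((\<lambda>W. {C \<in> \<K>. C \<inter> W \<noteq> {}}) ` \<W>')"]) simp
    qed
  qed
  then show ?thesis
    using \<B>(1) by (simp add: \<K>_def)
qed

section \<open>Spaces of closed chains\<close>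

text \<open>The three assumptions isolate what is needed of the tensor product for the Priestley
  part; stability under closed upsets is added only where downsets enter. Closedness is required in
  the hyperspace of all nonempty closed sets because compactness is known there.\<close>

context
  fixes X :: "'a topology" and r :: "'a rel" and \<K> :: "'a set set"
  assumes P: "priestley_space X r" and \<K>: "\<K> \<subseteq> CC X r"
    and closed: "closedin (clopen_vietoris X {C. closedin X C \<and> C \<noteq> {}}) \<K>"
begin

private lemma chain: "C \<in> \<K> \<Longrightarrow> x \<in> C \<Longrightarrow> y \<in> C \<Longrightarrow> (x, y) \<in> r \<or> (y, x) \<in> r"
  using \<K> by (auto simp: CC_def Chains_def)

private lemma subset_topspace: "C \<in> \<K> \<Longrightarrow> C \<subseteq> topspace X"
  using \<K> by (auto simp: CC_def dest: closedin_subset)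

private lemma compactin_chain: "C \<in> \<K> \<Longrightarrow> compactin X C"
  using \<K> P by (auto simp: CC_def priestley_space_def intro: closedin_compact_space)

private lemma topspace_eq: "topspace (clopen_vietoris X \<K>) = \<K>"
  by (rule topspace_clopen_vietoris) (rule subset_topspace)

private lemma order_iff: "(C, D) \<in> Restr (CC_order X r) \<K> \<longleftrightarrow> C \<in> \<K> \<and> D \<in> \<K> \<and> upset_of r C D"
  using \<K> by (auto simp: CC_order_def)

private lemma clopenin_meets:
  "clopenin X V \<Longrightarrow> clopenin (clopen_vietoris X \<K>) {C \<in> \<K>. C \<inter> V \<noteq> {}}"
  by (rule clopenin_clopen_vietoris_meets) (rule subset_topspace)

private lemma clopenin_misses:
  assumes "clopenin X V" shows "clopenin (clopen_vietoris X \<K>) {C \<in> \<K>. C \<inter> V = {}}"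
proof -
  have "{C \<in> \<K>. C \<inter> V = {}} = topspace (clopen_vietoris X \<K>) - {C \<in> \<K>. C \<inter> V \<noteq> {}}"
    by (auto simp: topspace_eq)
  then show ?thesis
    using clopenin_Diff[OF clopenin_topspace clopenin_meets[OF assms]] by simp
qed

lemma priestley_space_closed_chains:
  "priestley_space (clopen_vietoris X \<K>) (Restr (CC_order X r) \<K>)"
  unfolding priestley_space_def
proof (intro conjI ballI impI)
  let ?H = "{C. closedin X C \<and> C \<noteq> {}}"
  have "compactin (clopen_vietoris X ?H) \<K>"
    using closed P compact_space_clopen_vietoris
    by (auto simp: priestley_space_def intro: closedin_compact_space)
  moreover have "subtopology (clopen_vietoris X ?H) \<K> = clopen_vietoris X \<K>"
    by (rule subtopology_clopen_vietoris) (use \<K> in \<open>auto simp: CC_def\<close>)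
  ultimately show "compact_space (clopen_vietoris X \<K>)"
    using compact_space_subtopology by metis
  show "partial_order_on (topspace (clopen_vietoris X \<K>)) (Restr (CC_order X r) \<K>)"
    unfolding topspace_eq partial_order_on_def preorder_on_def
  proof (intro conjI)
    show "refl_on \<K> (Restr (CC_order X r) \<K>)"
      unfolding refl_on_def order_iff by (auto simp: upset_of_def)
    show "trans (Restr (CC_order X r) \<K>)"
      unfolding trans_def order_iff using upset_of_trans by blast
    show "antisym (Restr (CC_order X r) \<K>)"
      unfolding antisym_def order_iff by (auto simp: upset_of_def)
  qed blast
  fix C D
  assume "C \<in> topspace (clopen_vietoris X \<K>)" "D \<in> topspace (clopen_vietoris X \<K>)"
    and nCD: "(C, D) \<notin> Restr (CC_order X r) \<K>"
  then have C: "C \<in> \<K>" and D: "D \<in> \<K>"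
    by (simp_all add: topspace_eq)
  then have CD: "\<not> upset_of r C D"
    using nCD order_iff by blast
  note sub = subset_topspace[OF C] subset_topspace[OF D]
  show "\<exists>\<U>. clopenin (clopen_vietoris X \<K>) \<U> \<and>
      upset_of (Restr (CC_order X r) \<K>) (topspace (clopen_vietoris X \<K>)) \<U> \<and> C \<in> \<U> \<and> D \<notin> \<U>"
  proof (cases "D \<subseteq> C")
    case False
    then obtain y where "y \<in> D" "y \<notin> C"
      by blast
    then obtain V where V: "clopenin X V" "y \<in> V" "V \<inter> C = {}"
      using priestley_clopen_nhd[OF P compactin_chain[OF C]] sub by blast
    \<comment> \<open>Going up in the order shrinks the chain, so a chain that misses
      \<open>V\<close> keeps missing it.\<close>
    have "upset_of (Restr (CC_order X r) \<K>) \<K> {C \<in> \<K>. C \<inter> V = {}}"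
      unfolding upset_of_def[of _ \<K>] order_iff by (auto simp: upset_of_def)
    then show ?thesis
      unfolding topspace_eq using clopenin_misses[OF V(1)] V C \<open>y \<in> D\<close>
      by (intro exI[of _ "{C \<in> \<K>. C \<inter> V = {}}"]) blast
  next
    case True
    then obtain x y where xy: "x \<in> D" "y \<in> C" "(x, y) \<in> r" "y \<notin> D"
      using CD unfolding upset_of_def by blast
    then have "(y, x) \<notin> r"
      using priestley_partial_orderD(3)[OF P] by blast
    then obtain U where U: "clopenin X U" "upset_of r (topspace X) U" "y \<in> U" "x \<notin> U"
      using priestley_clopen_upset[OF P, of y x] xy sub by blast
    obtain V where V: "clopenin X V" "y \<in> V" "V \<inter> D = {}"
      using priestley_clopen_nhd[OF P compactin_chain[OF D], of y] xy sub by blast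
    \<comment> \<open>Read as an implication: a chain that leaves \<open>U\<close> must meet
      \<open>U \<inter> V\<close>. The point \<open>y\<close> puts \<open>C\<close> into this
      family; \<open>D\<close> stays out because \<open>x\<close> lies in \<open>D\<close> outside
      \<open>U\<close>, while \<open>V\<close> misses \<open>D\<close>.\<close>
    let ?\<U> = "{C \<in> \<K>. C \<inter> (topspace X - U) = {}} \<union> {C \<in> \<K>. C \<inter> (U \<inter> V) \<noteq> {}}"
    \<comment> \<open>In a chain, a point outside the upset \<open>U\<close> lies below every point of \<open>U\<close>.\<close>
    have "E' \<in> ?\<U>" if E: "E \<in> ?\<U>" "E' \<in> \<K>" "upset_of r E E'" for E E'
    proof (rule ccontr)
      assume "E' \<notin> ?\<U>"
      then obtain a where a: "a \<in> E'" "a \<in> topspace X - U" and E': "E' \<inter> (U \<inter> V) = {}"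
        using E(2) by blast
      have "a \<in> E"
        using a E(3) by (auto simp: upset_of_def)
      then obtain b where b: "b \<in> E" "b \<in> U" "b \<in> V" and "E \<in> \<K>"
        using a E(1) by blast
      then consider "(a, b) \<in> r" | "(b, a) \<in> r"
        using chain \<open>a \<in> E\<close> by blast
      then show False
        using a b E' E(3) U(2) unfolding upset_of_def by cases blast+
    qed
    then have "upset_of (Restr (CC_order X r) \<K>) \<K> ?\<U>"
      unfolding upset_of_def[of _ \<K>] order_iff by blast
    moreover have "clopenin (clopen_vietoris X \<K>) ?\<U>"
      by (intro clopenin_Un clopenin_misses clopenin_meets clopenin_Diff clopenin_Int clopenin_topspace U V)
    moreover have "C \<in> ?\<U>"
      using C xy U V by blast
    moreover have "D \<notin> ?\<U>"
      using xy U V sub by blast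
    ultimately show ?thesis
      unfolding topspace_eq by blast
  qed
qed

text \<open>This is the open half of the Esakia condition; the closed half holds in any Priestley
  space by \<open>priestley_closedin_downset\<close>.\<close>

lemma openin_downset_closed_chains:
  assumes sub: "\<And>C D. C \<in> \<K> \<Longrightarrow> D \<noteq> {} \<Longrightarrow> closedin X D \<Longrightarrow> upset_of r C D \<Longrightarrow> D \<in> \<K>"
    and S: "openin (clopen_vietoris X \<K>) S"
  shows "openin (clopen_vietoris X \<K>) ((Restr (CC_order X r) \<K>)\<inverse> `` S)"
proof (subst openin_subopen, intro ballI)
  fix C assume "C \<in> (Restr (CC_order X r) \<K>)\<inverse> `` S"
  then obtain D where "D \<in> S" "(C, D) \<in> Restr (CC_order X r) \<K>"
    by blast
  then have D: "D \<in> S" "D \<in> \<K>" and C: "C \<in> \<K>" and CD: "upset_of r C D"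
    by (simp_all only: order_iff)
  obtain V \<W> where V: "clopenin X V" "D \<subseteq> V"
    and \<W>: "finite \<W>" "\<And>W. W \<in> \<W> \<Longrightarrow> clopenin X W" "\<And>W. W \<in> \<W> \<Longrightarrow> D \<inter> W \<noteq> {}"
    and basis: "\<And>C. C \<in> \<K> \<Longrightarrow> C \<subseteq> V \<Longrightarrow> (\<And>W. W \<in> \<W> \<Longrightarrow> C \<inter> W \<noteq> {}) \<Longrightarrow> C \<in> S"
    using clopen_vietoris_basis[OF subset_topspace S D(1)] by metis
  have "compactin X ((topspace X - V) \<inter> C)"
    using clopenin_Diff[OF clopenin_topspace V(1)]
    by (intro closed_Int_compactin compactin_chain C) (simp add: clopenin_def)
  \<comment> \<open>\<open>D\<close> is an upset of \<open>C\<close> contained in \<open>V\<close>,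
    so no element of \<open>D\<close> lies below an element of \<open>C\<close> outside
    \<open>V\<close>.\<close>
  moreover have "(k, l) \<notin> r" if "k \<in> D" "l \<in> (topspace X - V) \<inter> C" for k l
    using that CD V(2) unfolding upset_of_def by blast
  ultimately obtain U where U: "clopenin X U" "upset_of r (topspace X) U" "D \<subseteq> U"
    "U \<inter> ((topspace X - V) \<inter> C) = {}"
    using priestley_compact_separation[OF P compactin_chain[OF D(2)]] by metis
  \<comment> \<open>Membership of \<open>E\<close> says that \<open>E \<inter> U\<close> lies in
    \<open>V\<close> and meets every \<open>W\<close> in \<open>\<W>\<close>, so that
    \<open>E \<inter> U\<close> satisfies the basic conditions for \<open>S\<close>. Inserting
    \<open>topspace X\<close> ensures that \<open>E \<inter> U\<close> is nonempty even when
    \<open>\<W>\<close> is empty.\<close>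
  let ?N = "{E \<in> \<K>. E \<subseteq> (topspace X - U) \<union> V} \<inter>
    \<Inter>((\<lambda>W. {E \<in> \<K>. E \<inter> (W \<inter> U) \<noteq> {}}) ` insert (topspace X) \<W>)"
  have "openin (clopen_vietoris X \<K>) ?N"
  proof (intro openin_Int openin_Inter)
    show "openin (clopen_vietoris X \<K>) {E \<in> \<K>. E \<subseteq> (topspace X - U) \<union> V}"
      by (intro openin_clopen_vietoris_subset clopenin_Un clopenin_Diff clopenin_topspace U V)
    fix T assume "T \<in> (\<lambda>W. {E \<in> \<K>. E \<inter> (W \<inter> U) \<noteq> {}}) ` insert (topspace X) \<W>"
    then obtain W where "clopenin X W" "T = {E \<in> \<K>. E \<inter> (W \<inter> U) \<noteq> {}}"
      using \<W>(2) clopenin_topspace by blast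
    then show "openin (clopen_vietoris X \<K>) T"
      using openin_clopen_vietoris_meets[OF clopenin_Int[OF _ U(1)]] by metis
  qed (use \<W>(1) in auto)
  moreover have "C \<in> ?N"
  proof -
    have "D \<subseteq> C" "D \<noteq> {}"
      using CD D(2) \<K> by (auto simp: upset_of_def CC_def)
    then have "C \<inter> (W \<inter> U) \<noteq> {}" if "W \<in> insert (topspace X) \<W>" for W
      using that \<W>(3) U(3) subset_topspace[OF D(2)] by blast
    moreover have "C \<subseteq> (topspace X - U) \<union> V"
      using U(4) subset_topspace[OF C] by blast
    ultimately show ?thesis
      using C by blast
  qed
  moreover have "?N \<subseteq> (Restr (CC_order X r) \<K>)\<inverse> `` S"
  proof
    fix E assume E: "E \<in> ?N"
    then have EK: "E \<in> \<K>"
      by blast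
    have up: "upset_of r E (E \<inter> U)"
      using U(2) subset_topspace[OF EK] unfolding upset_of_def by blast
    have "E \<inter> U \<in> \<K>"
    proof (rule sub[OF EK _ _ up])
      show "E \<inter> U \<noteq> {}"
        using E by blast
      show "closedin X (E \<inter> U)"
        using EK \<K> U(1) by (auto simp: CC_def clopenin_def)
    qed
    moreover from this have "E \<inter> U \<in> S"
      by (rule basis) (use E in blast)+
    ultimately show "E \<in> (Restr (CC_order X r) \<K>)\<inverse> `` S"
      using order_iff[of E "E \<inter> U"] EK up by blast
  qed
  ultimately show "\<exists>T. openin (clopen_vietoris X \<K>) T \<and> C \<in> T \<and> T \<subseteq> (Restr (CC_order X r) \<K>)\<inverse> `` S"
    by blast
qed

lemma esakia_root_system_closed_chains:
  assumes sub: "\<And>C D. C \<in> \<K> \<Longrightarrow> D \<noteq> {} \<Longrightarrow> closedin X D \<Longrightarrow> upset_of r C D \<Longrightarrow> D \<in> \<K>"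
  shows "esakia_root_system (clopen_vietoris X \<K>) (Restr (CC_order X r) \<K>)"
  unfolding esakia_root_system_def
proof (intro conjI allI impI ballI)
  show "priestley_space (clopen_vietoris X \<K>) (Restr (CC_order X r) \<K>)"
    by (rule priestley_space_closed_chains)
  fix S assume "clopenin (clopen_vietoris X \<K>) S"
  then show "clopenin (clopen_vietoris X \<K>) ((Restr (CC_order X r) \<K>)\<inverse> `` S)"
    unfolding clopenin_def
    by (intro conjI openin_downset_closed_chains
        priestley_closedin_downset[OF priestley_space_closed_chains]) (auto intro: sub)
next
  fix C assume "C \<in> topspace (clopen_vietoris X \<K>)"
  then have C: "C \<in> \<K>"
    by (simp add: topspace_eq)
  have "(D, E) \<in> Restr (CC_order X r) \<K> \<or> (E, D) \<in> Restr (CC_order X r) \<K>"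
    if "(C, D) \<in> Restr (CC_order X r) \<K>" "(C, E) \<in> Restr (CC_order X r) \<K>" for D E
  proof -
    have DE: "D \<in> \<K>" "E \<in> \<K>" "upset_of r C D" "upset_of r C E"
      using that by (simp_all only: order_iff)
    then have "D \<subseteq> C" "E \<subseteq> C"
      by (auto simp: upset_of_def)
    \<comment> \<open>Two upsets of one chain are nested: given \<open>d\<close> only in
      \<open>D\<close> and \<open>e\<close> only in \<open>E\<close>, whichever of them is larger
      would belong to both. The smaller upset is then an upset of the larger.\<close>
    moreover have "D \<subseteq> E \<or> E \<subseteq> D"
    proof (rule ccontr)
      assume "\<not> (D \<subseteq> E \<or> E \<subseteq> D)"
      then obtain d e where "d \<in> D" "d \<notin> E" "e \<in> E" "e \<notin> D"
        by blast
      then show False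
        using chain[OF C, of d e] DE(3,4) unfolding upset_of_def by blast
    qed
    ultimately have "upset_of r D E \<or> upset_of r E D"
      using upset_of_restrict DE(3,4) by blast
    then show ?thesis
      using DE(1,2) by (simp only: order_iff) blast
  qed
  then show "Restr (CC_order X r) \<K> `` {C} \<in> Chains (Restr (CC_order X r) \<K>)"
    unfolding Chains_def by blast
qed

end

section \<open>The tensor product\<close>

lemma closedin_tensor:
  fixes Y :: "'i \<Rightarrow> 'a topology"
  assumes Y: "\<And>i. i \<in> I \<Longrightarrow> esakia_root_system (Y i) (R i)"
  shows "closedin (clopen_vietoris (product_topology Y I) {C. closedin (product_topology Y I) C \<and> C \<noteq> {}})
    (tensor Y R I)"
proof -
  define X where "X = product_topology Y I"
  define r where "r = product_order Y R I"
  define \<K> where "\<K> = {C. closedin X C \<and> C \<noteq> {}}"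
  have PY: "\<And>i. i \<in> I \<Longrightarrow> priestley_space (Y i) (R i)"
    using Y by (simp add: esakia_root_system_def)
  then have P: "priestley_space X r"
    unfolding X_def r_def by (rule priestley_space_product)
  have \<K>: "\<And>C. C \<in> \<K> \<Longrightarrow> C \<subseteq> topspace X"
    by (simp add: \<K>_def closedin_subset)
  have top: "topspace (clopen_vietoris X \<K>) = \<K>"
    by (rule topspace_clopen_vietoris) (rule \<K>)
  have proj: "continuous_map X (Y i) (\<lambda>f. f i)" if "i \<in> I" for i
    unfolding X_def using that by (rule continuous_map_product_projection)
  have tensor: "C \<in> tensor Y R I \<longleftrightarrow> C \<in> \<K> \<and> C \<in> Chains r \<and>
      (\<forall>i\<in>I. upset_of (R i) (topspace (Y i)) ((\<lambda>f. f i) ` C))" for C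
    by (auto simp: tensor_def CC_def \<K>_def X_def r_def)
  have "openin (clopen_vietoris X \<K>) (\<K> - tensor Y R I)"
  proof (subst openin_subopen, intro ballI)
    fix C assume C: "C \<in> \<K> - tensor Y R I"
    then have sub: "C \<subseteq> topspace X"
      using \<K> by blast
    show "\<exists>T. openin (clopen_vietoris X \<K>) T \<and> C \<in> T \<and> T \<subseteq> \<K> - tensor Y R I"
    proof (cases "C \<in> Chains r")
      case False
      then obtain x y where xy: "x \<in> C" "y \<in> C" "(x, y) \<notin> r" "(y, x) \<notin> r"
        by (auto simp: Chains_def)
      obtain U where U: "clopenin X U" "upset_of r (topspace X) U" "x \<in> U" "y \<notin> U"
        using priestley_clopen_upset[OF P, of x y] xy sub by blast
      obtain V where V: "clopenin X V" "upset_of r (topspace X) V" "y \<in> V" "x \<notin> V"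
        using priestley_clopen_upset[OF P, of y x] xy sub by blast
      \<comment> \<open>Points of \<open>U - V\<close> and \<open>V - U\<close> are incomparable
        since both sets are upsets, so every set meeting both differences fails to be a
        chain.\<close>
      let ?T = "{C \<in> \<K>. C \<inter> (U - V) \<noteq> {}} \<inter> {C \<in> \<K>. C \<inter> (V - U) \<noteq> {}}"
      have "openin (clopen_vietoris X \<K>) ?T"
        by (intro openin_Int openin_clopen_vietoris_meets clopenin_Diff U V)
      moreover have "C \<in> ?T"
        using xy U V C by blast
      moreover have "E \<notin> Chains r" if "E \<in> ?T" for E
      proof -
        obtain a b where "a \<in> E" "b \<in> E" "a \<in> U" "a \<notin> V" "b \<in> V" "b \<notin> U"
          using \<open>E \<in> ?T\<close> by blast
        then have "(a, b) \<notin> r" "(b, a) \<notin> r"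
          using U(1,2) V(1,2) clopenin_subset unfolding upset_of_def by blast+
        then show ?thesis
          using \<open>a \<in> E\<close> \<open>b \<in> E\<close> by (auto simp: Chains_def)
      qed
      ultimately show ?thesis
        using tensor by blast
    next
      case True
      then obtain i where i: "i \<in> I" "\<not> upset_of (R i) (topspace (Y i)) ((\<lambda>f. f i) ` C)"
        using C tensor by blast
      have "(\<lambda>f. f i) ` C \<subseteq> topspace (Y i)"
        using continuous_map_image_subset_topspace[OF proj[OF i(1)]] sub by blast
      then obtain x y where xy: "x \<in> C" "y \<in> topspace (Y i)" "(x i, y) \<in> R i" "y \<notin> (\<lambda>f. f i) ` C"
        using i(2) unfolding upset_of_def by blast
      have "compactin X C"
        using C P by (auto simp: \<K>_def priestley_space_def intro: closedin_compact_space)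
      then have "compactin (Y i) ((\<lambda>f. f i) ` C)"
        using image_compactin proj[OF i(1)] by blast
      then obtain V where V: "clopenin (Y i) V" "y \<in> V" "V \<inter> (\<lambda>f. f i) ` C = {}"
        using priestley_clopen_nhd[OF PY[OF i(1)]] xy by metis
      \<comment> \<open>The point \<open>x\<close> witnesses that \<open>C\<close> meets
        \<open>?A\<close>, as \<open>x i\<close> lies below \<open>y\<close> in \<open>V\<close>. If
        a set \<open>E\<close> meets \<open>?A\<close> and its projection is an upset, that
        projection meets \<open>V\<close>, which \<open>E \<subseteq> ?B\<close> forbids. The Esakia
        condition on \<open>Y i\<close> is what makes \<open>?A\<close> clopen.\<close>
      let ?A = "{f \<in> topspace X. f i \<in> (R i)\<inverse> `` V}" and ?B = "{f \<in> topspace X. f i \<in> topspace (Y i) - V}"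
      let ?T = "{C \<in> \<K>. C \<inter> ?A \<noteq> {}} \<inter> {C \<in> \<K>. C \<subseteq> ?B}"
      have "clopenin (Y i) ((R i)\<inverse> `` V)"
        using Y[OF i(1)] V(1) by (simp add: esakia_root_system_def)
      then have "openin (clopen_vietoris X \<K>) ?T"
        by (intro openin_Int openin_clopen_vietoris_meets openin_clopen_vietoris_subset
            clopenin_preimage[OF proj[OF i(1)]] clopenin_Diff clopenin_topspace V)
      moreover have "C \<in> ?T"
        using C xy V sub \<open>(\<lambda>f. f i) ` C \<subseteq> topspace (Y i)\<close> by blast
      moreover have "\<not> upset_of (R i) (topspace (Y i)) ((\<lambda>f. f i) ` E)" if "E \<in> ?T" for E
      proof
        assume up: "upset_of (R i) (topspace (Y i)) ((\<lambda>f. f i) ` E)"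
        have "E \<inter> ?A \<noteq> {}"
          using that by simp
        then obtain f v where "f \<in> E" "(f i, v) \<in> R i" "v \<in> V"
          by blast
        then have "v \<in> (\<lambda>f. f i) ` E"
          using up clopenin_subset[OF V(1)] unfolding upset_of_def by blast
        then show False
          using that \<open>v \<in> V\<close> by blast
      qed
      ultimately show ?thesis
        using tensor i(1) by blast
    qed
  qed
  moreover have "tensor Y R I \<subseteq> \<K>"
    using tensor by blast
  ultimately have "closedin (clopen_vietoris X \<K>) (tensor Y R I)"
    by (simp add: closedin_def top)
  then show ?thesis
    by (simp add: \<K>_def X_def)
qed

text \<open>A value \<open>y\<close> above \<open>x i\<close>, with \<open>x\<close> in
  \<open>D\<close>, is attained as \<open>c i\<close> by some \<open>c\<close> in \<open>C\<close>,
  and \<open>c\<close> is comparable to \<open>x\<close>. If \<open>c\<close> is above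
  \<open>x\<close>, it belongs to \<open>D\<close>; if below, then
  \<open>c i \<le> x i \<le> y = c i\<close>, so \<open>y\<close> is already the value of
  \<open>x\<close>.\<close>

lemma tensor_upset:
  assumes PY: "\<And>i. i \<in> I \<Longrightarrow> priestley_space (Y i) (R i)"
    and C: "C \<in> tensor Y R I" and D: "D \<noteq> {}" "closedin (product_topology Y I) D"
    and CD: "upset_of (product_order Y R I) C D"
  shows "D \<in> tensor Y R I"
proof -
  have "D \<subseteq> C"
    using CD by (simp add: upset_of_def)
  have chain: "C \<in> Chains (product_order Y R I)"
    using C by (simp add: tensor_def CC_def)
  then have "D \<in> CC (product_topology Y I) (product_order Y R I)"
    using D \<open>D \<subseteq> C\<close> unfolding CC_def Chains_def by blast
  moreover have "upset_of (R i) (topspace (Y i)) ((\<lambda>f. f i) ` D)" if i: "i \<in> I" for i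
  proof -
    have up: "upset_of (R i) (topspace (Y i)) ((\<lambda>f. f i) ` C)"
      using C i by (simp add: tensor_def)
    have "y \<in> (\<lambda>f. f i) ` D" if x: "x \<in> D" "y \<in> topspace (Y i)" "(x i, y) \<in> R i" for x y
    proof -
      obtain c where c: "c \<in> C" "y = c i"
        using up x \<open>D \<subseteq> C\<close> unfolding upset_of_def by blast
      consider "(x, c) \<in> product_order Y R I" | "(c, x) \<in> product_order Y R I"
        using chain c(1) x(1) \<open>D \<subseteq> C\<close> unfolding Chains_def by blast
      then show ?thesis
      proof cases
        case 1
        then show ?thesis
          using CD c x(1) unfolding upset_of_def by blast
      next
        case 2
        then have "(c i, x i) \<in> R i"
          using i by (simp add: product_order_def)
        then have "y = x i"
          using priestley_partial_orderD(3)[OF PY[OF i]] x(3) c(2) by blast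
        then show ?thesis
          using x(1) by blast
      qed
    qed
    then show ?thesis
      using up \<open>D \<subseteq> C\<close> unfolding upset_of_def by blast
  qed
  ultimately show ?thesis
    by (simp add: tensor_def)
qed

theorem theorem4p6:
  fixes I :: "'i set"
    and Y :: "'i \<Rightarrow> 'a topology"
    and R :: "'i \<Rightarrow> 'a rel"
  assumes "\<And>i. i \<in> I \<Longrightarrow> esakia_root_system (Y i) (R i)"
  shows "esakia_root_system (tensor_topology Y R I) (tensor_order Y R I)"
proof -
  have PY: "\<And>i. i \<in> I \<Longrightarrow> priestley_space (Y i) (R i)"
    using assms by (simp add: esakia_root_system_def)
  have CC: "tensor Y R I \<subseteq> CC (product_topology Y I) (product_order Y R I)"
    by (auto simp: tensor_def)
  \<comment> \<open>The topology induced from \<open>CC\<close> is the Vietoris topology of the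
    tensor family itself, which brings the general result on closed families of chains to
    bear.\<close>
  have "tensor_topology Y R I = clopen_vietoris (product_topology Y I) (tensor Y R I)"
    unfolding tensor_topology_def CC_topology_eq by (rule subtopology_clopen_vietoris[OF CC])
  moreover have "esakia_root_system (clopen_vietoris (product_topology Y I) (tensor Y R I))
      (Restr (CC_order (product_topology Y I) (product_order Y R I)) (tensor Y R I))"
    by (rule esakia_root_system_closed_chains[OF priestley_space_product[OF PY] CC closedin_tensor[OF assms]
          tensor_upset[OF PY]])
  ultimately show ?thesis
    by (simp only: tensor_order_def)
qed

end
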